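(* Let $k$ and $\ell$ be integers with $k\geq\ell\geq 0$. Let $t=\lfloor k/(\ell+1)\rfloor$. Then every $k$-tree $G$ has an $\ell$-tree-partition in which each bag induces a connected $t$-tree in $G$.
   Context: All graphs are undirected, simple and finite (the graph with empty vertex set is allowed). $V(G)$ and $E(G)$ denote the vertex set and edge set of a graph $G$. A chord of a cycle $C$ in $G$ is an edge of $G$ not in $C$ whose endpoints are both in $C$; $G$ is chordal if every cycle on at least four vertices has a chord. For $k\ge 0$, a $k$-clique is a set of $k$ pairwise adjacent vertices. A $k$-tree is a chordal graph with no $(k+2)$-clique (note that this definition does not require all maximal cliques to have size $k+1$, nor connectedness). Let $G$ and $H$ be graphs; the elements of $V(H)$ are called nodes. An $H$-partition of $G$ is a pair $(H,\{H_x\subseteq V(G):x\in V(H)\})$, where the sets $H_x$ (called bags) are subsets of $V(G)$ indexed by the nodes of $H$, such that: (i) for every vertex $v$ of $G$ there is a node $x$ of $H$ with $v\in H_x$; (ii) for all distinct nodes $x,y$ of $H$, $H_x\cap H_y=\emptyset$; (iii) for every edge $vw$ of $G$, either there is a node $x$ of $H$ with $v\in H_x$ and $w\in H_x$, or there is an edge $xy$ of $H$ with $v\in H_x$ and $w\in H_y$. An $\ell$-tree-partition of $G$ is an $H$-partition of $G$ for some $\ell$-tree $H$. A bag $H_x$ induces a connected $t$-tree in $G$ if the induced subgraph $G[H_x]$ is connected and is a $t$-tree. *)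

theory Defs
  imports "Graph_Theory.Graph_Theory" "HOL-Library.Disjoint_Sets"
begin

text \<open>
  Finite simple undirected graphs are the symmetric digraphs satisfying \<^locale>\<open>graph\<close>; they may
  have no vertices. An undirected edge is a pair of opposite arcs, so \<^term>\<open>u \<rightarrow>\<^bsub>G\<^esub> v\<close> means
  that \<open>u\<close> and \<open>v\<close> are adjacent.
\<close>

text \<open>
  The library predicate \<^term>\<open>pre_digraph.cycle G p\<close> also holds of the closed walk \<open>u, v, u\<close> along a
  single edge; such walks are excluded in \<open>chordal\<close> by the bound on the number of vertices.
\<close>

definition cycle_verts :: "('a, 'b) pre_digraph \<Rightarrow> 'b awalk \<Rightarrow> 'a set" where
  "cycle_verts G p = tail G ` set p"

definition has_chord :: "('a, 'b) pre_digraph \<Rightarrow> 'b awalk \<Rightarrow> bool" where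
  "has_chord G p \<longleftrightarrow>
     (\<exists>u \<in> cycle_verts G p. \<exists>v \<in> cycle_verts G p.
        u \<rightarrow>\<^bsub>G\<^esub> v \<and> (\<forall>e \<in> set p. {tail G e, head G e} \<noteq> {u, v}))"

definition chordal :: "('a, 'b) pre_digraph \<Rightarrow> bool" where
  "chordal G \<longleftrightarrow>
     (\<forall>p. pre_digraph.cycle G p \<and> 4 \<le> card (cycle_verts G p) \<longrightarrow> has_chord G p)"

definition clique :: "('a, 'b) pre_digraph \<Rightarrow> nat \<Rightarrow> 'a set \<Rightarrow> bool" where
  "clique G k K \<longleftrightarrow> K \<subseteq> verts G \<and> finite K \<and> card K = k \<and> pairwise (dominates G) K"

definition k_tree :: "nat \<Rightarrow> ('a, 'b) pre_digraph \<Rightarrow> bool" where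
  "k_tree k G \<longleftrightarrow> graph G \<and> chordal G \<and> \<not> (\<exists>K. clique G (k + 2) K)"

definition H_partition ::
    "('a, 'b) pre_digraph \<Rightarrow> ('c, 'd) pre_digraph \<Rightarrow> ('c \<Rightarrow> 'a set) \<Rightarrow> bool" where
  "H_partition G H B \<longleftrightarrow>
     graph H \<and>
     (\<forall>x \<in> verts H. B x \<subseteq> verts G) \<and>
     (\<forall>v \<in> verts G. \<exists>x \<in> verts H. v \<in> B x) \<and>
     disjoint_family_on B (verts H) \<and>
     (\<forall>v w. v \<rightarrow>\<^bsub>G\<^esub> w \<longrightarrow>
        (\<exists>x \<in> verts H. v \<in> B x \<and> w \<in> B x) \<or>
        (\<exists>x y. x \<rightarrow>\<^bsub>H\<^esub> y \<and> v \<in> B x \<and> w \<in> B y))"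

definition tree_partition ::
    "nat \<Rightarrow> ('a, 'b) pre_digraph \<Rightarrow> ('c, 'd) pre_digraph \<Rightarrow> ('c \<Rightarrow> 'a set) \<Rightarrow> bool" where
  "tree_partition l G H B \<longleftrightarrow> k_tree l H \<and> H_partition G H B"

text \<open>
  \<^const>\<open>connected\<close> requires a nonempty vertex set, so a bag inducing a connected \<open>t\<close>-tree is
  nonempty.
\<close>

definition induces_connected_tree :: "nat \<Rightarrow> ('a, 'b) pre_digraph \<Rightarrow> 'a set \<Rightarrow> bool" where
  "induces_connected_tree t G S \<longleftrightarrow>
     Digraph_Component.connected (G \<restriction> S) \<and> k_tree t (G \<restriction> S)"

end

theory Submission
  imports Defs
begin

text \<open>
  The partition is built along a perfect elimination ordering. A chordal graph has a simplicial
  vertex \<open>v\<close>, one whose neighbours form a clique (\<open>exists_simplicial\<close>); deleting \<open>v\<close> leaves a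
  smaller \<open>k\<close>-tree, which by induction has an \<open>l\<close>-tree-partition with node graph \<open>E\<close> into bags
  inducing connected \<open>t\<close>-trees. The set \<open>N\<close> of neighbours of \<open>v\<close> is a clique with at most \<open>k\<close>
  vertices, because \<open>v\<close> extends it to a clique of a \<open>k\<close>-tree. Since adjacent vertices lie in
  equal or adjacent bags, the bags that meet \<open>N\<close> form a clique of \<open>E\<close>, so there are at most
  \<open>l + 1\<close> of them.

  If at most \<open>l\<close> bags meet \<open>N\<close>, then \<open>v\<close> becomes a bag of its own, whose node is joined to the
  nodes of these bags (\<open>partition_add_new_bag\<close>). The new node is simplicial of degree at most
  \<open>l\<close>, so the node graph stays chordal (\<open>hole_free_on_insert_simplicial\<close>) and gains no
  \<open>(l + 2)\<close>-clique. If exactly \<open>l + 1\<close> bags meet \<open>N\<close>, then one of them contains between \<open>1\<close> and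
  \<open>\<lfloor>k / (l + 1)\<rfloor> = t\<close> elements of \<open>N\<close> (\<open>exists_small_fibre\<close>), and \<open>v\<close> joins this bag
  (\<open>partition_add_to_bag\<close>). The node graph does not change: the other bags that meet \<open>N\<close> are
  already adjacent to the chosen one. The bag stays connected because \<open>v\<close> has a neighbour in it,
  and acquires no \<open>(t + 2)\<close>-clique because \<open>v\<close> has at most \<open>t\<close> neighbours in it. Bags are induced
  subgraphs of a chordal graph, so they are chordal without further argument.

  The combinatorics takes place on binary relations and vertex sets, where passing to a
  subgraph means passing to a subset. Chordality becomes the absence of holes, that is, of induced
  cycles with at least four vertices; the link with cycles given as arc walks is
  \<open>chordal_iff_hole_free\<close>.
\<close>

section \<open>Holes, cliques and connectivity for adjacency relations\<close>

definition induced_rel :: "('a \<Rightarrow> 'a \<Rightarrow> bool) \<Rightarrow> 'a set \<Rightarrow> 'a rel" where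
  "induced_rel R S = {(a, b). a \<in> S \<and> b \<in> S \<and> R a b}"

definition hole :: "('a \<Rightarrow> 'a \<Rightarrow> bool) \<Rightarrow> 'a list \<Rightarrow> bool" where
  "hole R vs \<longleftrightarrow> distinct vs \<and> 4 \<le> length vs \<and>
     (\<forall>i < length vs. \<forall>j < length vs.
        R (vs ! i) (vs ! j) \<longleftrightarrow> j = Suc i mod length vs \<or> i = Suc j mod length vs)"

definition hole_free_on :: "('a \<Rightarrow> 'a \<Rightarrow> bool) \<Rightarrow> 'a set \<Rightarrow> bool" where
  "hole_free_on R V \<longleftrightarrow> (\<forall>vs. set vs \<subseteq> V \<longrightarrow> \<not> hole R vs)"

definition cliques_at_most :: "('a \<Rightarrow> 'a \<Rightarrow> bool) \<Rightarrow> 'a set \<Rightarrow> nat \<Rightarrow> bool" where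
  "cliques_at_most R V m \<longleftrightarrow> (\<forall>K \<subseteq> V. pairwise R K \<longrightarrow> card K \<le> m)"

definition connected_on :: "('a \<Rightarrow> 'a \<Rightarrow> bool) \<Rightarrow> 'a set \<Rightarrow> bool" where
  "connected_on R S \<longleftrightarrow> S \<noteq> {} \<and> (\<forall>u \<in> S. \<forall>v \<in> S. (u, v) \<in> (induced_rel R S)\<^sup>*)"

definition simplicial_on :: "('a \<Rightarrow> 'a \<Rightarrow> bool) \<Rightarrow> 'a set \<Rightarrow> 'a \<Rightarrow> bool" where
  "simplicial_on R V v \<longleftrightarrow> v \<in> V \<and> pairwise R {x \<in> V. R v x}"

lemma hole_free_on_subset: "hole_free_on R V \<Longrightarrow> U \<subseteq> V \<Longrightarrow> hole_free_on R U"
  unfolding hole_free_on_def by blast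

lemma cliques_at_most_subset: "cliques_at_most R V m \<Longrightarrow> U \<subseteq> V \<Longrightarrow> cliques_at_most R U m"
  unfolding cliques_at_most_def by blast

section \<open>Simplicial vertices of chordal graphs\<close>

text \<open>
  The equivalence describes a shortest path only for symmetric irreflexive \<open>R\<close>: every vertex is
  then adjacent to its neighbours in the list and to no other vertex of it.
\<close>
fun induced_path :: "('a \<Rightarrow> 'a \<Rightarrow> bool) \<Rightarrow> 'a list \<Rightarrow> bool" where
  "induced_path R [] \<longleftrightarrow> True"
| "induced_path R (x # xs) \<longleftrightarrow>
     induced_path R xs \<and> x \<notin> set xs \<and> (\<forall>z \<in> set xs. R x z \<longleftrightarrow> z = hd xs)"

lemma induced_path_append: "induced_path R (ys @ zs) \<Longrightarrow> induced_path R zs"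
  by (induction ys) auto

lemma induced_path_distinct: "induced_path R xs \<Longrightarrow> distinct xs"
  by (induction xs) auto

lemma induced_path_nth:
  assumes "symp R" "irreflp R" "induced_path R xs" "i < length xs" "j < length xs"
  shows "R (xs ! i) (xs ! j) \<longleftrightarrow> j = Suc i \<or> i = Suc j"
  using assms(3-)
proof (induction xs arbitrary: i j)
  case Nil
  then show ?case by simp
next
  case (Cons x xs)
  have first: "R x (xs ! m) \<longleftrightarrow> m = 0" if "m < length xs" for m
  proof -
    have "R x (xs ! m) \<longleftrightarrow> xs ! m = hd xs"
      using Cons.prems(1) that by auto
    also have "\<dots> \<longleftrightarrow> m = 0"
      using that Cons.prems(1) induced_path_distinct[of R xs]
      by (cases xs) (auto simp: nth_eq_iff_index_eq nth_Cons split: nat.splits)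
    finally show ?thesis .
  qed
  have "R (xs ! m) x \<longleftrightarrow> R x (xs ! m)" for m
    using assms(1) by (meson sympD)
  moreover have "\<not> R x x"
    using assms(2) by (meson irreflpD)
  ultimately show ?case
    using Cons first by (auto simp: nth_Cons split: nat.splits)
qed

text \<open>
  The path is grown from its end. When \<open>c\<close> is put in front of an induced path, the path is first cut
  down to its suffix starting at the last vertex that equals \<open>c\<close> or is adjacent to \<open>c\<close>; later
  vertices then cause no chord.
\<close>
lemma walk_imp_induced_path:
  assumes "(a, b) \<in> (induced_rel R D)\<^sup>*" "b \<in> D"
  shows "\<exists>xs. induced_path R xs \<and> xs \<noteq> [] \<and> hd xs = a \<and> last xs = b \<and> set xs \<subseteq> D"
  using assms(1)
proof (induction rule: converse_rtrancl_induct)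
  case base
  then show ?case using assms(2) by (intro exI[of _ "[b]"]) auto
next
  case (step c d)
  then obtain xs where xs: "induced_path R xs" "xs \<noteq> []" "hd xs = d" "last xs = b" "set xs \<subseteq> D"
    by blast
  have cd: "c \<in> D" "R c d" using step.hyps(1) by (auto simp: induced_rel_def)
  have "\<exists>z \<in> set xs. R c z \<or> z = c" using cd xs by force
  then obtain ys z zs where split: "xs = ys @ z # zs" "R c z \<or> z = c"
      and later: "\<forall>y \<in> set zs. \<not> (R c y \<or> y = c)"
    using split_list_last_prop[of xs "\<lambda>z. R c z \<or> z = c"] by blast
  have suffix: "induced_path R (z # zs)" "last (z # zs) = b" "set (z # zs) \<subseteq> D"
    using xs split(1) induced_path_append[of R ys "z # zs"] by auto
  show ?case
  proof (cases "z = c")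
    case True
    then show ?thesis using suffix by (intro exI[of _ "z # zs"]) auto
  next
    case False
    then have "induced_path R (c # z # zs)"
      using suffix(1) split(2) later by auto
    then show ?thesis using suffix cd(1) by (intro exI[of _ "c # z # zs"]) auto
  qed
qed

text \<open>
  The bound on the length excludes a triangle: it makes the cycle through \<open>v\<close> have at least
  four vertices.
\<close>
lemma hole_Cons_induced_path:
  assumes "symp R" "irreflp R" "induced_path R xs" "3 \<le> length xs" "v \<notin> set xs"
    and nbrs: "\<And>z. z \<in> set xs \<Longrightarrow> R v z \<longleftrightarrow> z = hd xs \<or> z = last xs"
  shows "hole R (v # xs)"
proof -
  let ?n = "length xs"
  have d: "distinct xs" by (rule induced_path_distinct) fact
  have vz: "R v (xs ! m) \<longleftrightarrow> m = 0 \<or> Suc m = ?n" if "m < ?n" for m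
  proof -
    have "xs \<noteq> []" using that by auto
    then have "xs ! m = hd xs \<longleftrightarrow> m = 0" "xs ! m = last xs \<longleftrightarrow> m = ?n - 1"
      using that d by (simp_all add: hd_conv_nth last_conv_nth nth_eq_iff_index_eq)
    then show ?thesis using nbrs[of "xs ! m"] that by auto
  qed
  have zv: "R (xs ! m) v \<longleftrightarrow> R v (xs ! m)" for m
    using assms(1) by (meson sympD)
  have vv: "\<not> R v v" using assms(2) by (meson irreflpD)
  have "R ((v # xs) ! i) ((v # xs) ! j) \<longleftrightarrow> j = Suc i mod Suc ?n \<or> i = Suc j mod Suc ?n"
    if "i < Suc ?n" "j < Suc ?n" for i j
    using that assms(4) vz zv vv induced_path_nth[OF assms(1-3)]
    by (cases i; cases j) (auto simp: mod_Suc)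
  then show ?thesis
    using assms d by (auto simp: hole_def)
qed

lemma rtrancl_induced_rel_mono: 
  "(a, b) \<in> (induced_rel R S)\<^sup>* \<Longrightarrow> S \<subseteq> T \<Longrightarrow> (a, b) \<in> (induced_rel R T)\<^sup>*"
  by (erule rtrancl_mono[THEN subsetD, rotated]) (auto simp: induced_rel_def)

lemma rtrancl_induced_rel_sym:
  assumes "symp R" "(a, b) \<in> (induced_rel R S)\<^sup>*"
  shows "(b, a) \<in> (induced_rel R S)\<^sup>*"
proof -
  have "sym (induced_rel R S)"
    using assms(1) by (auto simp: sym_def induced_rel_def dest: sympD)
  then show ?thesis using assms(2) by (meson sym_rtrancl symD)
qed

text \<open>
  Two nonadjacent elements \<open>a\<close> and \<open>b\<close> of this set would be joined by a walk through the connected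
  set \<open>C\<close>, hence by an induced path with interior in \<open>C\<close>. As \<open>v\<close> is adjacent to both ends and to
  nothing in \<open>C\<close>, adding \<open>v\<close> would close this path to a hole.
\<close>
lemma component_boundary_clique:
  assumes "symp R" "irreflp R" "hole_free_on R V" "v \<in> V" "C \<subseteq> V" "v \<notin> C"
    and far: "\<And>c. c \<in> C \<Longrightarrow> \<not> R v c"
    and conn: "\<And>c d. c \<in> C \<Longrightarrow> d \<in> C \<Longrightarrow> (c, d) \<in> (induced_rel R C)\<^sup>*"
  shows "pairwise R {s \<in> V. R v s \<and> (\<exists>c \<in> C. R s c)}"
proof (rule pairwiseI, rule ccontr)
  fix a b
  assume a: "a \<in> {s \<in> V. R v s \<and> (\<exists>c \<in> C. R s c)}" and b: "b \<in> {s \<in> V. R v s \<and> (\<exists>c \<in> C. R s c)}"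
    and ab: "a \<noteq> b" "\<not> R a b"
  obtain c d where cd: "c \<in> C" "R a c" "d \<in> C" "R b d" using a b by blast
  let ?D = "insert a (insert b C)"
  have "(a, c) \<in> induced_rel R ?D" "(d, b) \<in> induced_rel R ?D"
    using cd assms(1) by (auto simp: induced_rel_def dest: sympD)
  moreover have "(c, d) \<in> (induced_rel R ?D)\<^sup>*"
    using conn[OF cd(1,3)] by (rule rtrancl_induced_rel_mono) auto
  ultimately have "(a, b) \<in> (induced_rel R ?D)\<^sup>*"
    by (meson converse_rtrancl_into_rtrancl rtrancl.rtrancl_into_rtrancl)
  then obtain xs where xs: "induced_path R xs" "xs \<noteq> []" "hd xs = a" "last xs = b" "set xs \<subseteq> ?D"
    using walk_imp_induced_path[of a b R ?D] by auto
  \<comment> \<open>Two or fewer vertices would force \<open>a = b\<close> or an edge \<open>ab\<close>.\<close>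
  have "3 \<le> length xs"
    using xs ab by (cases xs; cases "tl xs"; cases "tl (tl xs)") auto
  moreover have "v \<noteq> a" "v \<noteq> b" using a b assms(2) by (auto dest: irreflpD)
  then have "v \<notin> set xs" using xs(5) assms(6) by auto
  moreover have "R v z \<longleftrightarrow> z = hd xs \<or> z = last xs" if "z \<in> set xs" for z
    using that xs far a b by auto
  ultimately have "hole R (v # xs)"
    using hole_Cons_induced_path[OF assms(1,2) xs(1)] by blast
  moreover have "set (v # xs) \<subseteq> V" using xs(5) a b assms(4,5) by auto
  ultimately show False using assms(3) unfolding hole_free_on_def by blast
qed

text \<open>
  This strengthening of Dirac's theorem makes the induction work: it locates the simplicial vertex
  away from a prescribed vertex \<open>v\<close>. Let \<open>C\<close> be the component of \<open>w\<close> in the graph of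
  non-neighbours of \<open>v\<close>, and \<open>S\<close> the set of neighbours of \<open>v\<close> that have a neighbour in \<open>C\<close>. Vertices
  of \<open>C\<close> have all their neighbours in \<open>C \<union> S\<close>, so a vertex of \<open>C\<close> that is simplicial in the smaller
  graph on \<open>C \<union> S\<close> is simplicial in the whole graph. The set \<open>S\<close> is a clique by the previous
  lemma. If \<open>C \<union> S\<close> is a clique, then \<open>w\<close> is simplicial; otherwise, applying the induction
  hypothesis to a suitable vertex of \<open>C \<union> S\<close> yields a simplicial vertex outside \<open>S\<close>.
\<close>
lemma exists_simplicial_non_neighbour:
  assumes "finite V" "symp R" "irreflp R" "hole_free_on R V"
    and "v \<in> V" "w \<in> V" "w \<noteq> v" "\<not> R v w"
  shows "\<exists>x. simplicial_on R V x \<and> x \<noteq> v \<and> \<not> R v x"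
  using assms(1,4-)
proof (induction V arbitrary: v w rule: finite_psubset_induct)
  case (psubset V)
  note sym = sympD[OF assms(2)]
  define F where "F = {x \<in> V. x \<noteq> v \<and> \<not> R v x}"
  define C where "C = {x. (w, x) \<in> (induced_rel R F)\<^sup>*}"
  define S where "S = {s \<in> V. R v s \<and> (\<exists>c \<in> C. R s c)}"
  have wC: "w \<in> C" by (simp add: C_def)
  have wF: "w \<in> F" using psubset.prems by (simp add: F_def)
  have CF: "C \<subseteq> F"
  proof
    fix x assume "x \<in> C"
    then have "(w, x) \<in> (induced_rel R F)\<^sup>*" by (simp add: C_def)
    then show "x \<in> F" using wF by (induction rule: rtrancl_induct) (auto simp: induced_rel_def)
  qed
  have C_step: "y \<in> C" if "x \<in> C" "y \<in> F" "R x y" for x y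
  proof -
    have "(x, y) \<in> induced_rel R F" using that CF by (auto simp: induced_rel_def)
    then show ?thesis using that(1) by (auto simp: C_def intro: rtrancl_into_rtrancl)
  qed
  have from_w: "(w, x) \<in> (induced_rel R C)\<^sup>*" if "x \<in> C" for x
  proof -
    have "(w, x) \<in> (induced_rel R F)\<^sup>*" using that by (simp add: C_def)
    then show ?thesis
    proof (induction rule: rtrancl_induct)
      case (step y z)
      have "y \<in> C" "z \<in> C"
        using step.hyps by (auto simp: C_def intro: rtrancl_into_rtrancl)
      then have "(y, z) \<in> induced_rel R C" using step.hyps(2) by (auto simp: induced_rel_def)
      then show ?case using step.IH by (rule rtrancl_into_rtrancl[rotated])
    qed simp
  qed
  have conn: "(c, d) \<in> (induced_rel R C)\<^sup>*" if "c \<in> C" "d \<in> C" for c d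
    using rtrancl_induced_rel_sym[OF assms(2) from_w[OF that(1)]] from_w[OF that(2)]
    by (rule rtrancl_trans)
  have S_clique: "pairwise R S"
    unfolding S_def
    by (rule component_boundary_clique[OF assms(2,3) psubset.prems(1,2)])
       (use CF conn in \<open>auto simp: F_def\<close>)
  have closed: "y \<in> C \<union> S" if "x \<in> C" "y \<in> V" "R x y" for x y
    using that C_step[of x y] CF sym by (auto simp: F_def S_def)
  let ?U = "C \<union> S"
  have UV: "?U \<subset> V"
    using CF psubset.prems(2) assms(3) by (auto simp: F_def S_def dest: irreflpD)
  have hU: "hole_free_on R ?U"
    using psubset.prems(1) UV by (meson hole_free_on_subset psubset_imp_subset)
  have "\<exists>x \<in> C. simplicial_on R ?U x"
  proof (cases "pairwise R ?U")
    case True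
    then have "simplicial_on R ?U w"
      using wC unfolding simplicial_on_def pairwise_def by blast
    then show ?thesis using wC by blast
  next
    case False
    show ?thesis
    proof (cases "\<exists>s \<in> S. \<exists>u \<in> ?U. u \<noteq> s \<and> \<not> R s u")
      case True
      \<comment> \<open>A simplicial vertex other than \<open>s\<close> that is not adjacent to \<open>s\<close> avoids the clique \<open>S\<close>.\<close>
      then obtain s u where su: "s \<in> S" "u \<in> ?U" "u \<noteq> s" "\<not> R s u" by blast
      then obtain x where x: "simplicial_on R ?U x" "x \<noteq> s" "\<not> R s x"
        using psubset.IH[OF UV hU, of s u] by blast
      moreover have "x \<notin> S" using pairwiseD[OF S_clique su(1), of x] x(2,3) by auto
      ultimately show ?thesis unfolding simplicial_on_def by blast
    next
      case univ: False
      \<comment> \<open>Every vertex of \<open>S\<close> is adjacent to all others, so \<open>p\<close> and its non-neighbours avoid \<open>S\<close>.\<close>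
      obtain p q where pq: "p \<in> ?U" "q \<in> ?U" "p \<noteq> q" "\<not> R p q"
        using False unfolding pairwise_def by blast
      then obtain x where x: "simplicial_on R ?U x" "x \<noteq> p" "\<not> R p x"
        using psubset.IH[OF UV hU, of p q] by blast
      moreover have "x \<notin> S"
      proof
        assume "x \<in> S"
        then have "R x p" using univ pq(1) x(2) by metis
        then show False using sym x(3) by metis
      qed
      ultimately show ?thesis unfolding simplicial_on_def by blast
    qed
  qed
  then obtain x where x: "x \<in> C" "simplicial_on R ?U x" by blast
  have "{y \<in> V. R x y} \<subseteq> {y \<in> ?U. R x y}" using closed x(1) by blast
  then have "simplicial_on R V x"
    using x CF unfolding simplicial_on_def F_def by (auto intro: pairwise_subset)
  then show ?case using x(1) CF by (auto simp: F_def)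
qed

lemma exists_simplicial:
  assumes "finite V" "symp R" "irreflp R" "hole_free_on R V" "V \<noteq> {}"
  shows "\<exists>x. simplicial_on R V x"
proof (cases "pairwise R V")
  case True
  then show ?thesis using assms(5) unfolding simplicial_on_def pairwise_def by blast
next
  case False
  then obtain v w where "v \<in> V" "w \<in> V" "w \<noteq> v" "\<not> R v w" unfolding pairwise_def by blast
  from exists_simplicial_non_neighbour[OF assms(1-4) this] show ?thesis by blast
qed

text \<open>
  A hole through \<open>v\<close> contains two neighbours of \<open>v\<close>, which are adjacent because \<open>v\<close> is simplicial
  but lie two steps apart on the hole.
\<close>
lemma hole_free_on_insert_simplicial:
  assumes "symp R" "hole_free_on R V" "simplicial_on R (insert v V) v"
  shows "hole_free_on R (insert v V)"
  unfolding hole_free_on_def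
proof (intro allI impI notI)
  fix vs assume vs: "set vs \<subseteq> insert v V" "hole R vs"
  let ?n = "length vs"
  have n: "4 \<le> ?n" and d: "distinct vs" using vs(2) by (auto simp: hole_def)
  have adj: "R (vs ! i) (vs ! j) \<longleftrightarrow> j = Suc i mod ?n \<or> i = Suc j mod ?n"
    if "i < ?n" "j < ?n" for i j
    using vs(2) that by (auto simp: hole_def)
  have "v \<in> set vs" using vs assms(2) unfolding hole_free_on_def by blast
  then obtain i where i: "i < ?n" "vs ! i = v" by (auto simp: in_set_conv_nth)
  \<comment> \<open>The successor and the predecessor of \<open>v\<close> on the hole.\<close>
  define k where "k = Suc i mod ?n"
  define j where "j = (if i = 0 then ?n - 1 else i - 1)"
  have k: "k < ?n" unfolding k_def using n by (intro mod_less_divisor) linarith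
  have j: "j < ?n" using n i by (auto simp: j_def)
  have ij: "i = Suc j mod ?n" using n i by (auto simp: j_def)
  have "j \<noteq> k" "k \<noteq> Suc j mod ?n" "j \<noteq> Suc k mod ?n"
    using n i by (auto simp: j_def k_def mod_Suc split: if_splits)
  moreover have "R v (vs ! k)" "R v (vs ! j)"
    using adj[of i k] adj[of i j] i j k ij by (auto simp: k_def)
  moreover have "vs ! k \<noteq> vs ! j"
    using d j k \<open>j \<noteq> k\<close> by (simp add: nth_eq_iff_index_eq)
  moreover have "vs ! k \<in> insert v V" "vs ! j \<in> insert v V"
    using vs(1) j k by (auto simp: subset_iff)
  ultimately have "R (vs ! k) (vs ! j)"
    using assms(3) unfolding simplicial_on_def pairwise_def by blast
  with adj[OF k j] \<open>k \<noteq> Suc j mod ?n\<close> \<open>j \<noteq> Suc k mod ?n\<close> show False by simp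
qed

section \<open>Building the partition along an elimination ordering\<close>

lemma hole_cong:
  assumes "\<And>x y. x \<in> set vs \<Longrightarrow> y \<in> set vs \<Longrightarrow> R x y = Q x y"
  shows "hole R vs \<longleftrightarrow> hole Q vs"
  using assms by (simp add: hole_def)

lemma hole_free_on_cong:
  assumes "\<And>x y. x \<in> V \<Longrightarrow> y \<in> V \<Longrightarrow> R x y = Q x y"
  shows "hole_free_on R V \<longleftrightarrow> hole_free_on Q V"
  unfolding hole_free_on_def using assms hole_cong[of _ R Q] by blast

lemma cliques_at_most_cong:
  assumes "\<And>x y. x \<in> V \<Longrightarrow> y \<in> V \<Longrightarrow> R x y = Q x y"
  shows "cliques_at_most R V m \<longleftrightarrow> cliques_at_most Q V m"
proof -
  have "pairwise R K \<longleftrightarrow> pairwise Q K" if "K \<subseteq> V" for K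
    using that assms by (auto simp: pairwise_def subset_iff)
  then show ?thesis by (auto simp: cliques_at_most_def)
qed

text \<open>
  This bounds the cliques of the enlarged bag and those of the enlarged node graph: a clique
  containing \<open>v\<close> consists of \<open>v\<close> and some of its neighbours.
\<close>
lemma cliques_at_most_insert:
  assumes "finite V" "cliques_at_most R V (Suc m)" "card {x \<in> V. R v x} \<le> m"
  shows "cliques_at_most R (insert v V) (Suc m)"
  unfolding cliques_at_most_def
proof (intro allI impI)
  fix K assume K: "K \<subseteq> insert v V" "pairwise R K"
  show "card K \<le> Suc m"
  proof (cases "v \<in> K")
    case True
    have "K - {v} \<subseteq> {x \<in> V. R v x}" using K True by (auto simp: pairwise_def)
    then have "card (K - {v}) \<le> m"
      using assms(1,3) card_mono[of "{x \<in> V. R v x}" "K - {v}"] by simp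
    then show ?thesis using True by (simp add: card_Diff_singleton_if)
  next
    case False
    then show ?thesis using K assms(2) by (auto simp: cliques_at_most_def)
  qed
qed

lemma cliques_at_most_singleton: "cliques_at_most R {v} (Suc m)"
  unfolding cliques_at_most_def
proof (intro allI impI)
  fix K assume "K \<subseteq> {v}"
  then show "card K \<le> Suc m" using card_mono[of "{v}" K] by simp
qed

lemma connected_on_singleton: "connected_on R {v}"
  by (auto simp: connected_on_def)

lemma connected_on_insert:
  assumes "symp R" "connected_on R S" "u \<in> S" "R v u"
  shows "connected_on R (insert v S)"
proof -
  let ?T = "(induced_rel R (insert v S))\<^sup>*"
  have "(x, u) \<in> ?T" if "x \<in> insert v S" for x
  proof (cases "x = v")
    case True
    then show ?thesis using assms(3,4) by (auto simp: induced_rel_def)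
  next
    case False
    then have "(x, u) \<in> (induced_rel R S)\<^sup>*" using assms(2,3) that by (auto simp: connected_on_def)
    then show ?thesis by (rule rtrancl_induced_rel_mono) auto
  qed
  then show ?thesis
    unfolding connected_on_def
    using rtrancl_induced_rel_sym[OF assms(1)] by (blast intro: rtrancl_trans)
qed

text \<open>
  Pigeonhole principle: if all \<open>l + 1\<close> fibres had more than \<open>\<lfloor>k / (l + 1)\<rfloor>\<close> elements, then \<open>N\<close>
  would have more than \<open>k\<close>.
\<close>
lemma exists_small_fibre:
  assumes "finite N" "card N \<le> k" "card (b ` N) = Suc l"
  shows "\<exists>x \<in> b ` N. card {u \<in> N. b u = x} \<le> k div Suc l"
proof (rule ccontr)
  assume "\<not> ?thesis"
  then have large: "Suc (k div Suc l) \<le> card {u \<in> N. b u = x}" if "x \<in> b ` N" for x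
    using that by (auto simp: not_le Suc_le_eq)
  have "k < Suc l * Suc (k div Suc l)"
    by (metis dividend_less_div_times mult.commute mult_Suc_right zero_less_Suc)
  also have "\<dots> = (\<Sum>x \<in> b ` N. Suc (k div Suc l))" using assms(3) by simp
  also have "\<dots> \<le> (\<Sum>x \<in> b ` N. card {u \<in> N. b u = x})" by (rule sum_mono) (rule large)
  also have "\<dots> = card N" using sum.image_gen[OF assms(1), of "\<lambda>_. 1 :: nat" b] by simp
  finally show False using assms(2) by simp
qed

definition bag :: "'a set \<Rightarrow> ('a \<Rightarrow> nat) \<Rightarrow> nat \<Rightarrow> 'a set" where
  "bag V b x = {v \<in> V. b v = x}"

lemma bag_insert:
  assumes "v \<notin> V"
  shows "bag (insert v V) (b(v := y)) x = (if x = y then insert v (bag V b x) else bag V b x)"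
  using assms by (auto simp: bag_def)

text \<open>
  The nodes are the numbers below \<open>n\<close>, and \<open>b\<close> maps each vertex to the node of its bag, so
  that the bags cover \<open>V\<close> and are disjoint by construction. The clique bounds exceed \<open>l\<close> and \<open>t\<close> by
  one, as an \<open>l\<close>-tree may contain an \<open>(l + 1)\<close>-clique. The relation \<open>E\<close> may also relate numbers that
  are not nodes.
\<close>
definition partition_on_nodes ::
    "nat \<Rightarrow> nat \<Rightarrow> ('a \<Rightarrow> 'a \<Rightarrow> bool) \<Rightarrow> 'a set \<Rightarrow> nat \<Rightarrow> (nat \<Rightarrow> nat \<Rightarrow> bool) \<Rightarrow> ('a \<Rightarrow> nat) \<Rightarrow> bool" where
  "partition_on_nodes l t R V n E b \<longleftrightarrow>
     symp E \<and> irreflp E \<and> hole_free_on E {..<n} \<and> cliques_at_most E {..<n} (Suc l) \<and>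
     b ` V \<subseteq> {..<n} \<and>
     (\<forall>u \<in> V. \<forall>v \<in> V. R u v \<longrightarrow> b u = b v \<or> E (b u) (b v)) \<and>
     (\<forall>x < n. connected_on R (bag V b x) \<and> cliques_at_most R (bag V b x) (Suc t))"

text \<open>
  The node graph is kept: a neighbour of \<open>v\<close> lies in the bag of \<open>x\<close> or in a bag whose node
  belongs with \<open>x\<close> to the clique of nodes seen by \<open>v\<close>.
\<close>
lemma partition_add_to_bag:
  assumes "partition_on_nodes l t R V n E b" "symp R" "finite V" "v \<notin> V"
    and "x \<in> b ` {u \<in> V. R v u}" "pairwise E (b ` {u \<in> V. R v u})"
    and "card {u \<in> {u \<in> V. R v u}. b u = x} \<le> t"
  shows "partition_on_nodes l t R (insert v V) n E (b(v := x))"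
proof -
  note P = assms(1)[unfolded partition_on_nodes_def]
  obtain u where u: "u \<in> V" "R v u" "x = b u" using assms(5) by blast
  have xn: "x < n" using u P by auto
  have fin: "finite (bag V b x)" using assms(3) by (simp add: bag_def)
  have "connected_on R (insert v (bag V b x))"
    using P xn u by (intro connected_on_insert[OF assms(2), of _ u]) (auto simp: bag_def)
  moreover have "{y \<in> bag V b x. R v y} = {u \<in> {u \<in> V. R v u}. b u = x}"
    by (auto simp: bag_def)
  then have "cliques_at_most R (insert v (bag V b x)) (Suc t)"
    using P xn assms(7) by (intro cliques_at_most_insert[OF fin]) auto
  ultimately have bags: "\<forall>y < n. connected_on R (bag (insert v V) (b(v := x)) y) \<and>
      cliques_at_most R (bag (insert v V) (b(v := x)) y) (Suc t)"
    using P assms(4) by (auto simp: bag_insert)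
  have new: "x = b w \<or> E x (b w)" "b w = x \<or> E (b w) x" if "w \<in> V" "R v w \<or> R w v" for w
  proof -
    have "R v w" using that(2) assms(2) by (auto dest: sympD)
    then have "b w \<in> b ` {u \<in> V. R v u}" using that(1) by blast
    then show "x = b w \<or> E x (b w)" "b w = x \<or> E (b w) x"
      using pairwiseD[OF assms(6,5), of "b w"] pairwiseD[OF assms(6) _ assms(5), of "b w"] by auto
  qed
  have "(b(v := x)) w = (b(v := x)) z \<or> E ((b(v := x)) w) ((b(v := x)) z)"
    if "w \<in> insert v V" "z \<in> insert v V" "R w z" for w z
    using that P new(1)[of z] new(2)[of w] by auto
  then show ?thesis
    using P xn bags assms(4) unfolding partition_on_nodes_def by auto
qed

text \<open>
  Joining the new node \<open>n\<close> exactly to the clique \<open>I\<close> of nodes seen by \<open>v\<close> makes \<open>n\<close> simplicial.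
\<close>
lemma partition_add_new_bag:
  assumes "partition_on_nodes l t R V n E b" "symp R" "irreflp R" "v \<notin> V"
    and clique: "pairwise E (b ` {u \<in> V. R v u})" and small: "card (b ` {u \<in> V. R v u}) \<le> l"
  shows "\<exists>E'. partition_on_nodes l t R (insert v V) (Suc n) E' (b(v := n))"
proof -
  note P = assms(1)[unfolded partition_on_nodes_def]
  define I where "I = b ` {u \<in> V. R v u}"
  have In: "I \<subseteq> {..<n}" using P by (auto simp: I_def)
  \<comment> \<open>\<open>E\<close> is first restricted to the old nodes, since it may relate \<open>n\<close> to something.\<close>
  define E' where "E' x y \<longleftrightarrow> x < n \<and> y < n \<and> E x y \<or> x = n \<and> y \<in> I \<or> y = n \<and> x \<in> I" for x y
  have old: "E' x y = E x y" if "x < n" "y < n" for x y using that by (auto simp: E'_def)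
  have symE: "symp E'" using P by (auto simp: symp_def E'_def)
  have irrE: "irreflp E'" using P In by (auto simp: irreflp_def E'_def)
  have upd: "{..<Suc n} = insert n {..<n}" by auto
  have nbrs: "{x \<in> {..<n}. E' n x} = I" using In by (auto simp: E'_def)
  have hf: "hole_free_on E' {..<n}"
    using P hole_free_on_cong[of "{..<n}" E' E] old by simp
  have "{x \<in> insert n {..<n}. E' n x} = I" using nbrs irrE by (auto dest: irreflpD)
  moreover have "pairwise E' I"
    using clique In old unfolding pairwise_def I_def[symmetric] by (auto simp: subset_iff)
  ultimately have "simplicial_on E' (insert n {..<n}) n" by (simp add: simplicial_on_def)
  then have hole_free: "hole_free_on E' {..<Suc n}"
    unfolding upd using hole_free_on_insert_simplicial[OF symE hf] by blast
  have "cliques_at_most E' {..<n} (Suc l)"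
    using P cliques_at_most_cong[of "{..<n}" E' E] old by simp
  then have cl: "cliques_at_most E' {..<Suc n} (Suc l)"
    unfolding upd using small nbrs by (intro cliques_at_most_insert) (auto simp: I_def)
  have new: "bag V b n = {}" using P by (auto simp: bag_def)
  have bags: "connected_on R (bag (insert v V) (b(v := n)) x) \<and>
      cliques_at_most R (bag (insert v V) (b(v := n)) x) (Suc t)" if "x < Suc n" for x
    using that P assms(4) new
    by (auto simp: bag_insert connected_on_singleton cliques_at_most_singleton)
  have "(b(v := n)) w = (b(v := n)) z \<or> E' ((b(v := n)) w) ((b(v := n)) z)"
    if "w \<in> insert v V" "z \<in> insert v V" "R w z" for w z
  proof -
    have new_edges: "E' n (b y)" "E' (b y) n" if "y \<in> V" "R v y \<or> R y v" for y
      using that assms(2) by (auto simp: E'_def I_def dest: sympD)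
    have old_edges: "b w = b z \<or> E' (b w) (b z)" if "w \<in> V" "z \<in> V"
    proof -
      have "b w < n" "b z < n" "b w = b z \<or> E (b w) (b z)"
        using that \<open>R w z\<close> P by auto
      then show ?thesis using old by auto
    qed
    show ?thesis using that new_edges old_edges by auto
  qed
  moreover have "(b(v := n)) ` insert v V \<subseteq> {..<Suc n}" using P assms(4) by auto
  ultimately show ?thesis
    using symE irrE hole_free cl bags unfolding partition_on_nodes_def by blast
qed

text \<open>
  Induction on the number of vertices, removing a simplicial vertex \<open>v\<close>. The number of bags
  containing neighbours of \<open>v\<close> decides which of the two extension steps applies.
\<close>
lemma exists_partition:
  assumes "finite V" "symp R" "irreflp R" "hole_free_on R V" "cliques_at_most R V (Suc k)"
  shows "\<exists>n E b. partition_on_nodes l (k div Suc l) R V n E b"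
  using assms(1,4,5)
proof (induction "card V" arbitrary: V)
  case 0
  then show ?case
    by (intro exI[of _ 0] exI[of _ "\<lambda>_ _. False"])
       (auto simp: partition_on_nodes_def hole_free_on_def hole_def cliques_at_most_def symp_def irreflp_def)
next
  case (Suc m)
  then have "V \<noteq> {}" by auto
  then obtain v where v: "simplicial_on R V v"
    using exists_simplicial[OF _ assms(2,3)] Suc.prems by blast
  define W where "W = V - {v}"
  have V: "V = insert v W" and vW: "v \<notin> W" and WV: "W \<subseteq> V"
    using v by (auto simp: W_def simplicial_on_def)
  have fin: "finite W" using Suc.prems V by simp
  have "m = card W" using Suc.hyps(2) V vW fin by simp
  then obtain n E b where P: "partition_on_nodes l (k div Suc l) R W n E b"
    using Suc.hyps(1) fin hole_free_on_subset[OF Suc.prems(2) WV]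
      cliques_at_most_subset[OF Suc.prems(3) WV] by blast
  let ?N = "{u \<in> W. R v u}"
  have N: "pairwise R ?N"
    using v WV unfolding simplicial_on_def by (auto intro: pairwise_subset)
  have "insert v ?N \<subseteq> V" using V by auto
  moreover have "pairwise R (insert v ?N)"
    using N assms(2) by (auto simp: pairwise_insert dest: sympD)
  ultimately have "card (insert v ?N) \<le> Suc k"
    using Suc.prems(3) by (simp add: cliques_at_most_def)
  then have Nk: "card ?N \<le> k" using fin vW by simp
  \<comment> \<open>Neighbours of \<open>v\<close> in different bags are adjacent, and so are their bags.\<close>
  have clique: "pairwise E (b ` ?N)"
  proof (rule pairwiseI)
    fix x y assume "x \<in> b ` ?N" "y \<in> b ` ?N" "x \<noteq> y"
    then obtain u w where "u \<in> ?N" "w \<in> ?N" "x = b u" "y = b w" "u \<noteq> w" by blast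
    moreover from this have "R u w" using N by (simp add: pairwise_def)
    ultimately show "E x y" using P \<open>x \<noteq> y\<close> unfolding partition_on_nodes_def by blast
  qed
  have "b ` ?N \<subseteq> {..<n}" using P by (auto simp: partition_on_nodes_def)
  then have "card (b ` ?N) \<le> Suc l"
    using P clique by (simp add: partition_on_nodes_def cliques_at_most_def)
  then consider "card (b ` ?N) \<le> l" | "card (b ` ?N) = Suc l" by linarith
  then show ?case
  proof cases
    case 1
    then show ?thesis using partition_add_new_bag[OF P assms(2,3) vW clique] V by blast
  next
    case 2
    then obtain x where "x \<in> b ` ?N" "card {u \<in> ?N. b u = x} \<le> k div Suc l"
      using exists_small_fibre[OF _ Nk 2] fin by auto
    then show ?thesis using partition_add_to_bag[OF P assms(2) fin vW _ clique] V by blast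
  qed
qed

section \<open>Cycles as arc walks and holes as vertex lists\<close>

lemma (in pre_digraph) cas_iff_nth:
  assumes "p \<noteq> []"
  shows "cas u p v \<longleftrightarrow> tail G (hd p) = u \<and> head G (last p) = v \<and>
    (\<forall>i. Suc i < length p \<longrightarrow> head G (p ! i) = tail G (p ! Suc i))"
  using assms
proof (induction p arbitrary: u)
  case (Cons e es)
  show ?case
  proof (cases "es = []")
    case False
    have split_0: "(\<forall>i. Q i) \<longleftrightarrow> Q 0 \<and> (\<forall>i. Q (Suc i))" for Q :: "nat \<Rightarrow> bool"
      by (metis not0_implies_Suc)
    have "(\<forall>i. Suc i < length (e # es) \<longrightarrow> head G ((e # es) ! i) = tail G ((e # es) ! Suc i))
      \<longleftrightarrow> head G e = tail G (hd es) \<and>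
        (\<forall>i. Suc i < length es \<longrightarrow> head G (es ! i) = tail G (es ! Suc i))"
      using False by (subst split_0) (simp add: hd_conv_nth)
    then show ?thesis using Cons.IH[OF False, of "head G e"] False by auto
  qed simp
qed simp

text \<open>
  Indices are taken modulo the length, as in the definition of a hole. A cycle is thereby
  determined by the cyclic list of the tails of its arcs; the heads form the same list, rotated by
  one.
\<close>
lemma (in wf_digraph) cycle_iff_nth:
  "cycle p \<longleftrightarrow> p \<noteq> [] \<and> set p \<subseteq> arcs G \<and> distinct (map (tail G) p) \<and>
     (\<forall>i < length p. head G (p ! i) = tail G (p ! (Suc i mod length p)))"
proof (cases "p = []")
  case False
  let ?n = "length p"
  let ?closed = "\<forall>i < ?n. head G (p ! i) = tail G (p ! (Suc i mod ?n))"
  have closed: "?closed \<longleftrightarrow> cas (tail G (hd p)) p (tail G (hd p))"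
  proof
    assume c: ?closed
    have "head G (last p) = tail G (hd p)"
      using c[rule_format, of "?n - 1"] False by (simp add: last_conv_nth hd_conv_nth)
    moreover have "head G (p ! i) = tail G (p ! Suc i)" if "Suc i < ?n" for i
      using c[rule_format, of i] that by simp
    ultimately show "cas (tail G (hd p)) p (tail G (hd p))" using False by (simp add: cas_iff_nth)
  next
    assume c: "cas (tail G (hd p)) p (tail G (hd p))"
    show ?closed
    proof (intro allI impI)
      fix i assume "i < ?n"
      then consider "i = ?n - 1" | "Suc i < ?n" by linarith
      then show "head G (p ! i) = tail G (p ! (Suc i mod ?n))"
        using c False by cases (auto simp: cas_iff_nth last_conv_nth hd_conv_nth)
    qed
  qed
  have heads: "map (head G) p = rotate1 (map (tail G) p)" if ?closed
    using that False by (intro nth_equalityI) (auto simp: nth_rotate1)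
  have "tail G (hd p) \<in> verts G" if "set p \<subseteq> arcs G"
    using that False hd_in_set[of p] by (intro tail_in_verts) auto
  then have "cycle p \<longleftrightarrow> set p \<subseteq> arcs G \<and> distinct (map (head G) p) \<and> ?closed"
    unfolding closed using False
    by (auto simp: cycle_def awalk_def awalk_verts_conv' cas_iff_nth)
  also have "\<dots> \<longleftrightarrow> set p \<subseteq> arcs G \<and> distinct (map (tail G) p) \<and> ?closed"
    using heads by (metis distinct1_rotate)
  finally show ?thesis using False by blast
qed (simp add: cycle_def)

lemma cycle_verts_conv_set: "cycle_verts G p = set (map (tail G) p)"
  by (simp add: cycle_verts_def)

context graph
begin

lemma symp_dominates: "symp (dominates G)"
  by (rule sympI) (rule arcs_ends_symmetric[OF sym_arcs])

lemma irreflp_dominates: "irreflp (dominates G)"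
  by (rule irreflpI) (rule notI, rule adj_not_same)

text \<open>
  Without chords every edge between vertices of the cycle is one of its arcs up to direction, and
  an arc joins cyclically consecutive vertices.
\<close>
lemma chordless_cycle_imp_hole:
  assumes "cycle p" "4 \<le> card (cycle_verts G p)" "\<not> has_chord G p"
  shows "hole (dominates G) (map (tail G) p)"
proof -
  let ?n = "length p"
  have p: "set p \<subseteq> arcs G" "distinct (map (tail G) p)"
    and next_tail: "\<And>i. i < ?n \<Longrightarrow> head G (p ! i) = tail G (p ! (Suc i mod ?n))"
    using assms(1) by (auto simp: cycle_iff_nth)
  have inj: "tail G (p ! i) = tail G (p ! j) \<longleftrightarrow> i = j" if "i < ?n" "j < ?n" for i j
    using that nth_eq_iff_index_eq[OF p(2), of i j] by simp
  have "distinct (map (tail G) p) \<Longrightarrow> card (cycle_verts G p) = ?n"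
    unfolding cycle_verts_conv_set by (metis distinct_card length_map)
  then have n: "4 \<le> ?n" using assms(2) p(2) by simp
  have arc: "tail G (p ! i) \<rightarrow> tail G (p ! (Suc i mod ?n))" if "i < ?n" for i
    using that p(1) next_tail[OF that]
    by (intro dominatesI[of "p ! i"]) (auto simp: arc_to_ends_def)
  have "tail G (p ! i) \<rightarrow> tail G (p ! j) \<longleftrightarrow> j = Suc i mod ?n \<or> i = Suc j mod ?n"
    if ij: "i < ?n" "j < ?n" for i j
  proof
    assume "tail G (p ! i) \<rightarrow> tail G (p ! j)"
    moreover have "tail G (p ! i) \<in> cycle_verts G p" "tail G (p ! j) \<in> cycle_verts G p"
      using ij by (auto simp: cycle_verts_def)
    ultimately obtain e where "e \<in> set p" "{tail G e, head G e} = {tail G (p ! i), tail G (p ! j)}"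
      using assms(3) unfolding has_chord_def by blast
    then obtain m where m: "m < ?n"
        "{tail G (p ! m), tail G (p ! (Suc m mod ?n))} = {tail G (p ! i), tail G (p ! j)}"
      using next_tail by (metis in_set_conv_nth)
    moreover have "Suc m mod ?n < ?n" using m(1) by (intro mod_less_divisor) linarith
    ultimately show "j = Suc i mod ?n \<or> i = Suc j mod ?n"
      using inj ij by (auto simp: doubleton_eq_iff)
  next
    assume "j = Suc i mod ?n \<or> i = Suc j mod ?n"
    then show "tail G (p ! i) \<rightarrow> tail G (p ! j)"
      using arc ij symp_dominates by (metis sympD)
  qed
  then show ?thesis using p(2) n by (auto simp: hole_def)
qed

text \<open>
  Choosing an arc between any two consecutive vertices of the hole gives the cycle. All edges
  between vertices of the hole join consecutive ones, so each has one of the chosen arcs over it.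
\<close>
lemma hole_imp_chordless_cycle:
  assumes "hole (dominates G) vs"
  shows "\<exists>p. cycle p \<and> 4 \<le> card (cycle_verts G p) \<and> \<not> has_chord G p"
proof -
  let ?n = "length vs"
  have d: "distinct vs" and n: "4 \<le> ?n"
    and adj: "\<And>i j. i < ?n \<Longrightarrow> j < ?n \<Longrightarrow>
      vs ! i \<rightarrow> vs ! j \<longleftrightarrow> j = Suc i mod ?n \<or> i = Suc j mod ?n"
    using assms by (auto simp: hole_def)
  have lt: "Suc i mod ?n < ?n" for i using n by (intro mod_less_divisor) linarith
  have "\<exists>e. e \<in> arcs G \<and> tail G e = vs ! i \<and> head G e = vs ! (Suc i mod ?n)" if "i < ?n" for i
    using adj[OF that lt[of i]] by (auto elim: reachableE)
  then obtain e where e: "\<And>i. i < ?n \<Longrightarrow>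
      e i \<in> arcs G \<and> tail G (e i) = vs ! i \<and> head G (e i) = vs ! (Suc i mod ?n)"
    by metis
  define p where "p = map e [0..<?n]"
  have len: "length p = ?n" by (simp add: p_def)
  have tails: "map (tail G) p = vs"
    using e by (intro nth_equalityI) (auto simp: p_def)
  have "cycle p"
    unfolding cycle_iff_nth tails len using d n e lt by (auto simp: p_def)
  moreover have verts_p: "cycle_verts G p = set vs"
    unfolding cycle_verts_conv_set tails ..
  moreover have "\<not> has_chord G p"
  proof
    assume "has_chord G p"
    then obtain i j where ij: "i < ?n" "j < ?n" "vs ! i \<rightarrow> vs ! j"
        and no_arc: "\<forall>a \<in> set p. {tail G a, head G a} \<noteq> {vs ! i, vs ! j}"
      unfolding has_chord_def verts_p by (metis in_set_conv_nth)
    have "e i \<in> set p" "e j \<in> set p" using ij by (auto simp: p_def)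
    then show False using adj[OF ij(1,2)] ij e[of i] e[of j] no_arc by (metis insert_commute)
  qed
  ultimately show ?thesis using d n distinct_card by metis
qed

lemma chordal_iff_hole_free: "chordal G \<longleftrightarrow> hole_free_on (dominates G) (verts G)"
proof
  assume "chordal G"
  then show "hole_free_on (dominates G) (verts G)"
    using hole_imp_chordless_cycle unfolding chordal_def hole_free_on_def by blast
next
  assume hf: "hole_free_on (dominates G) (verts G)"
  show "chordal G"
    unfolding chordal_def
  proof (intro allI impI, elim conjE, rule ccontr)
    fix p assume p: "cycle p" "4 \<le> card (cycle_verts G p)" "\<not> has_chord G p"
    have "set (map (tail G) p) \<subseteq> verts G" using p(1) by (auto simp: cycle_iff_nth)
    then show False using chordless_cycle_imp_hole[OF p] hf unfolding hole_free_on_def by blast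
  qed
qed

text \<open>
  A clique with more than \<open>m\<close> vertices contains one with exactly \<open>m + 1\<close>.
\<close>
lemma no_clique_iff:
  "\<not> (\<exists>K. clique G (Suc m) K) \<longleftrightarrow> cliques_at_most (dominates G) (verts G) m"
proof
  assume none: "\<not> (\<exists>K. clique G (Suc m) K)"
  show "cliques_at_most (dominates G) (verts G) m"
    unfolding cliques_at_most_def
  proof (intro allI impI, rule ccontr)
    fix K assume K: "K \<subseteq> verts G" "pairwise (dominates G) K" "\<not> card K \<le> m"
    then obtain L where L: "L \<subseteq> K" "card L = Suc m" "finite L"
      by (meson not_less_eq_eq obtain_subset_with_card_n)
    then have "clique G (Suc m) L"
      unfolding clique_def using K pairwise_subset[OF K(2) L(1)] by blast
    then show False using none by blast
  qed
next
  assume "cliques_at_most (dominates G) (verts G) m"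
  then show "\<not> (\<exists>K. clique G (Suc m) K)"
    unfolding cliques_at_most_def clique_def by (metis not_less_eq_eq order_refl)
qed

lemma k_tree_iff:
  "k_tree k G \<longleftrightarrow>
     hole_free_on (dominates G) (verts G) \<and> cliques_at_most (dominates G) (verts G) (Suc k)"
  using graph_axioms no_clique_iff[of "Suc k"] by (simp add: k_tree_def chordal_iff_hole_free)

lemma graph_induce_subgraph:
  assumes "S \<subseteq> verts G"
  shows "graph (G \<restriction> S)"
proof -
  interpret S: wf_digraph "G \<restriction> S" ..
  show ?thesis
    using assms finite_subset[OF assms] no_loops no_multi_arcs
      induced_graph_imp_symmetric[OF sym_arcs induced_induce[OF assms]]
    by unfold_locales auto
qed

end

section \<open>Induced subgraphs and node graphs as digraphs\<close>

lemma dominates_induce_subgraph: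
  "u \<rightarrow>\<^bsub>G \<restriction> S\<^esub> v \<longleftrightarrow> u \<in> S \<and> v \<in> S \<and> u \<rightarrow>\<^bsub>G\<^esub> v"
  by (auto simp: arcs_ends_conv)

lemma connected_induce_subgraph:
  assumes "connected_on (dominates G) S"
  shows "Digraph_Component.connected (G \<restriction> S)"
  unfolding connected_conv
proof (intro conjI ballI)
  show "verts (G \<restriction> S) \<noteq> {}" using assms by (simp add: connected_on_def)
next
  fix u v assume uv: "u \<in> verts (G \<restriction> S)" "v \<in> verts (G \<restriction> S)"
  then have "(u, v) \<in> (induced_rel (dominates G) S)\<^sup>*"
    using assms by (simp add: connected_on_def)
  then show "(u, v) \<in> rtrancl_on (verts (G \<restriction> S)) ((arcs_ends (G \<restriction> S))\<^sup>s)"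
  proof (induction rule: rtrancl_induct)
    case base
    then show ?case using uv by auto
  next
    case (step y z)
    have "(y, z) \<in> (arcs_ends (G \<restriction> S))\<^sup>s" "z \<in> S"
      using step.hyps(2) by (auto simp: symcl_def induced_rel_def dominates_induce_subgraph)
    then show ?case using step.IH by (auto intro: rtrancl_on_into_rtrancl_on)
  qed
qed

lemma (in graph) induces_connected_treeI:
  assumes "S \<subseteq> verts G" "hole_free_on (dominates G) (verts G)"
    and "connected_on (dominates G) S" "cliques_at_most (dominates G) S (Suc t)"
  shows "induces_connected_tree t G S"
proof -
  interpret S: graph "G \<restriction> S" by (rule graph_induce_subgraph) fact
  have "hole_free_on (dominates G) S" using assms(2,1) by (rule hole_free_on_subset)
  then have "hole_free_on (dominates (G \<restriction> S)) S"
    using hole_free_on_cong[of S "dominates (G \<restriction> S)" "dominates G"]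
    by (simp add: dominates_induce_subgraph)
  moreover have "cliques_at_most (dominates (G \<restriction> S)) S (Suc t)"
    using assms(4) cliques_at_most_cong[of S "dominates (G \<restriction> S)" "dominates G"]
    by (simp add: dominates_induce_subgraph)
  ultimately show ?thesis
    using connected_induce_subgraph[OF assms(3)] S.k_tree_iff
    by (simp add: induces_connected_tree_def)
qed

definition graph_on_nodes :: "nat \<Rightarrow> (nat \<Rightarrow> nat \<Rightarrow> bool) \<Rightarrow> (nat, nat \<times> nat) pre_digraph" where
  "graph_on_nodes n E =
     \<lparr>verts = {..<n}, arcs = {(x, y). x < n \<and> y < n \<and> E x y}, tail = fst, head = snd\<rparr>"

lemma dominates_graph_on_nodes:
  "x \<rightarrow>\<^bsub>graph_on_nodes n E\<^esub> y \<longleftrightarrow> x < n \<and> y < n \<and> E x y"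
  by (force simp: arcs_ends_conv graph_on_nodes_def)

lemma graph_graph_on_nodes:
  assumes "symp E" "irreflp E"
  shows "graph (graph_on_nodes n E)"
proof -
  have "finite {(x, y). x < n \<and> y < n \<and> E x y}"
    by (rule finite_subset[of _ "{..<n} \<times> {..<n}"]) auto
  moreover have "symmetric (graph_on_nodes n E)"
    unfolding symmetric_def sym_def dominates_graph_on_nodes using assms(1) by (auto dest: sympD)
  ultimately show ?thesis
    using assms(2)
    by unfold_locales (auto simp: graph_on_nodes_def arc_to_ends_def dest: irreflpD)
qed

section \<open>Tree-partitions of \<open>k\<close>-trees\<close>

theorem theorem1:
  fixes k l t :: nat and G :: "('a, 'b) pre_digraph"
  assumes "l \<le> k"
    and "t = k div (l + 1)"
    and "k_tree k G"
  shows "\<exists>(H :: (nat, nat \<times> nat) pre_digraph) B.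
           tree_partition l G H B \<and>
           (\<forall>x \<in> verts H. induces_connected_tree t G (B x))"
proof -
  interpret G: graph G using assms(3) by (simp add: k_tree_def)
  let ?R = "dominates G" and ?V = "verts G"
  have G: "hole_free_on ?R ?V" "cliques_at_most ?R ?V (Suc k)"
    using assms(3) G.k_tree_iff by auto
  have "k div Suc l = t" using assms(2) by simp
  then obtain n E b where P: "partition_on_nodes l t ?R ?V n E b"
    using exists_partition[OF G.finite_verts G.symp_dominates G.irreflp_dominates G, of l] by blast
  note P' = P[unfolded partition_on_nodes_def]
  define H where "H = graph_on_nodes n E"
  interpret H: graph H unfolding H_def using P' by (intro graph_graph_on_nodes) auto
  have verts_H: "verts H = {..<n}" by (simp add: H_def graph_on_nodes_def)
  have adj_H: "x \<rightarrow>\<^bsub>H\<^esub> y \<longleftrightarrow> x < n \<and> y < n \<and> E x y" for x y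
    unfolding H_def by (rule dominates_graph_on_nodes)
  have "hole_free_on (dominates H) {..<n}"
    using P' hole_free_on_cong[of "{..<n}" "dominates H" E] by (simp add: adj_H)
  moreover have "cliques_at_most (dominates H) {..<n} (Suc l)"
    using P' cliques_at_most_cong[of "{..<n}" "dominates H" E] by (simp add: adj_H)
  ultimately have "k_tree l H" by (simp add: H.k_tree_iff verts_H)
  moreover have "H_partition G H (bag ?V b)"
    unfolding H_partition_def
  proof (intro conjI allI impI ballI)
    show "graph H" by (rule H.graph_axioms)
    show "disjoint_family_on (bag ?V b) (verts H)"
      by (auto simp: disjoint_family_on_def bag_def)
    show "\<exists>x \<in> verts H. v \<in> bag ?V b x" if "v \<in> ?V" for v
      using that P' by (auto simp: verts_H bag_def)
    show "bag ?V b x \<subseteq> ?V" for x by (auto simp: bag_def)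
    fix v w assume vw: "v \<rightarrow>\<^bsub>G\<^esub> w"
    have V: "v \<in> ?V" "w \<in> ?V" using G.adj_in_verts[OF vw] by auto
    then have "b v < n" "b w < n" "b v = b w \<or> E (b v) (b w)" using P' vw by auto
    then show "(\<exists>x \<in> verts H. v \<in> bag ?V b x \<and> w \<in> bag ?V b x) \<or>
        (\<exists>x y. x \<rightarrow>\<^bsub>H\<^esub> y \<and> v \<in> bag ?V b x \<and> w \<in> bag ?V b y)"
      using V by (auto simp: verts_H adj_H bag_def)
  qed
  moreover have "induces_connected_tree t G (bag ?V b x)" if "x \<in> verts H" for x
    using that P' G(1) by (intro G.induces_connected_treeI) (auto simp: verts_H bag_def)
  ultimately show ?thesis unfolding tree_partition_def by blast
qed

end
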